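(* There exists a real-valued semimartingale $X=(X_t)_{t\ge 0}$ with càdlàg paths, defined on some filtered probability space with probability measure $\mathbb{P}$, such that for every (deterministic) sequence $\pi=(\pi_n)_{n\ge 1}$ of partitions of $[0,\infty)$, $$\mathbb{P}\big(J(X)\subset \liminf_{n}\pi_n\big)=0 .$$
   Context: A partition sequence is a sequence $\pi=(\pi_n)_{n\ge1}$ of finite sets $\pi_n=\{0=t^n_0<\dots<t^n_{k_n}<\infty\}$ of points of $[0,\infty)$ with $t^n_{k_n}\to\infty$ and with mesh $\sup_i|t^n_i-t^n_{i-1}|$ vanishing on compacts as $n\to\infty$. $\liminf_n\pi_n:=\bigcup_{n}\bigcap_{k\ge n}\pi_k$. For a càdlàg path $x$ on $[0,\infty)$ (with the convention $x(0-):=x(0)$), $J(x):=\{t\in[0,\infty): x(t-)\neq x(t)\}$ is its set of discontinuity times; $J(X)$ is the random set of discontinuity times of the sample path of $X$. *)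

theory Defs
  imports "HOL-Probability.Probability"
begin

text \<open>The time axis is \<open>[0, \<infinity>)\<close>. Paths, processes and filtrations are functions on
  \<^typ>\<open>real\<close>, and only their values at nonnegative times are ever constrained or used.\<close>

section \<open>Cadlag paths and partition sequences\<close>

definition cadlag :: "(real \<Rightarrow> real) \<Rightarrow> bool" where
  "cadlag x \<longleftrightarrow>
     (\<forall>t\<ge>0. continuous (at_right t) x) \<and>
     (\<forall>t>0. \<exists>l. (x \<longlongrightarrow> l) (at_left t))"

definition left_lim :: "(real \<Rightarrow> real) \<Rightarrow> real \<Rightarrow> real" where
  "left_lim x t = (if t = 0 then x 0 else Lim (at_left t) x)"

definition jump_times :: "(real \<Rightarrow> real) \<Rightarrow> real set" where
  "jump_times x = {t. 0 \<le> t \<and> left_lim x t \<noteq> x t}"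

text \<open>For a partition \<open>0 = t\<^sub>0 < \<dots> < t\<^sub>k\<close>, the largest of the numbers
  \<open>\<bar>min t\<^sub>i T - min t\<^sub>i\<^sub>-\<^sub>1 T\<bar>\<close>. Truncating the points at \<open>T\<close>, rather than discarding those
  beyond \<open>T\<close>, keeps the interval that straddles \<open>T\<close>. The inserted \<open>0\<close> covers \<open>k = 0\<close>.\<close>

definition mesh_upto :: "real set \<Rightarrow> real \<Rightarrow> real" where
  "mesh_upto A T =
     (let t = (\<lambda>i. sorted_list_of_set A ! i)
      in Max (insert 0 ((\<lambda>i. \<bar>min (t i) T - min (t (i - 1)) T\<bar>) ` {1..<card A})))"

text \<open>Sequences are indexed from \<open>1\<close>; the value at \<open>0\<close> is irrelevant.\<close>

definition partition_sequence :: "(nat \<Rightarrow> real set) \<Rightarrow> bool" where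
  "partition_sequence \<pi> \<longleftrightarrow>
     (\<forall>n\<ge>1. finite (\<pi> n) \<and> 0 \<in> \<pi> n \<and> \<pi> n \<subseteq> {0..}) \<and>
     filterlim (\<lambda>n. Max (\<pi> n)) at_top sequentially \<and>
     (\<forall>T\<ge>0. (\<lambda>n. mesh_upto (\<pi> n) T) \<longlonglongrightarrow> 0)"

definition liminf_sets :: "(nat \<Rightarrow> real set) \<Rightarrow> real set" where
  "liminf_sets \<pi> = (\<Union>n\<in>{1..}. \<Inter>k\<in>{n..}. \<pi> k)"

section \<open>Semimartingales\<close>

locale filtered_prob_space = prob_space P for P :: "'a measure" +
  fixes F :: "real \<Rightarrow> 'a measure"
  assumes subalgebra_F: "\<And>t. 0 \<le> t \<Longrightarrow> subalgebra P (F t)"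
    and F_mono: "\<And>s t. 0 \<le> s \<Longrightarrow> s \<le> t \<Longrightarrow> sets (F s) \<subseteq> sets (F t)"

definition adapted :: "(real \<Rightarrow> 'a measure) \<Rightarrow> (real \<Rightarrow> 'a \<Rightarrow> real) \<Rightarrow> bool" where
  "adapted F X \<longleftrightarrow> (\<forall>t\<ge>0. X t \<in> borel_measurable (F t))"

definition cadlag_process :: "'a measure \<Rightarrow> (real \<Rightarrow> 'a \<Rightarrow> real) \<Rightarrow> bool" where
  "cadlag_process P X \<longleftrightarrow> (\<forall>\<omega>\<in>space P. cadlag (\<lambda>t. X t \<omega>))"

definition martingale ::
    "'a measure \<Rightarrow> (real \<Rightarrow> 'a measure) \<Rightarrow> (real \<Rightarrow> 'a \<Rightarrow> real) \<Rightarrow> bool" where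
  "martingale P F X \<longleftrightarrow>
     adapted F X \<and>
     (\<forall>t\<ge>0. integrable P (X t)) \<and>
     (\<forall>s t. 0 \<le> s \<and> s \<le> t \<longrightarrow> (AE \<omega> in P. real_cond_exp P (F s) (X t) \<omega> = X s \<omega>))"

text \<open>The library's \<^const>\<open>stopping_time\<close> needs stopping times and filtration to have the same
  index type; here times may be infinite while the filtration lives on \<open>[0, \<infinity>)\<close>.\<close>

definition ext_stopping_time ::
    "'a measure \<Rightarrow> (real \<Rightarrow> 'a measure) \<Rightarrow> ('a \<Rightarrow> ennreal) \<Rightarrow> bool" where
  "ext_stopping_time P F \<tau> \<longleftrightarrow>
     (\<forall>t\<ge>0. {\<omega> \<in> space P. \<tau> \<omega> \<le> ennreal t} \<in> sets (F t))"

definition stopped :: "(real \<Rightarrow> 'a \<Rightarrow> real) \<Rightarrow> ('a \<Rightarrow> ennreal) \<Rightarrow> real \<Rightarrow> 'a \<Rightarrow> real" where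
  "stopped X \<tau> t \<omega> = X (enn2real (min (ennreal t) (\<tau> \<omega>))) \<omega>"

text \<open>Subtracting the initial value avoids requiring it to be integrable.\<close>

definition local_martingale ::
    "'a measure \<Rightarrow> (real \<Rightarrow> 'a measure) \<Rightarrow> (real \<Rightarrow> 'a \<Rightarrow> real) \<Rightarrow> bool" where
  "local_martingale P F X \<longleftrightarrow>
     adapted F X \<and> cadlag_process P X \<and>
     (\<exists>\<tau> :: nat \<Rightarrow> 'a \<Rightarrow> ennreal.
        (\<forall>n. ext_stopping_time P F (\<tau> n)) \<and>
        (AE \<omega> in P. incseq (\<lambda>n. \<tau> n \<omega>) \<and> (\<lambda>n. \<tau> n \<omega>) \<longlonglongrightarrow> \<infinity>) \<and>
        (\<forall>n. martingale P F (\<lambda>t \<omega>. stopped X (\<tau> n) t \<omega> - X 0 \<omega>)))"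

definition bounded_variation_upto :: "(real \<Rightarrow> real) \<Rightarrow> real \<Rightarrow> bool" where
  "bounded_variation_upto x T \<longleftrightarrow>
     (\<exists>C. \<forall>ts. sorted ts \<and> set ts \<subseteq> {0..T} \<longrightarrow>
        (\<Sum>i<length ts - 1. \<bar>x (ts ! Suc i) - x (ts ! i)\<bar>) \<le> C)"

definition finite_variation_process ::
    "'a measure \<Rightarrow> (real \<Rightarrow> 'a measure) \<Rightarrow> (real \<Rightarrow> 'a \<Rightarrow> real) \<Rightarrow> bool" where
  "finite_variation_process P F A \<longleftrightarrow>
     adapted F A \<and> cadlag_process P A \<and>
     (\<forall>\<omega>\<in>space P. \<forall>T\<ge>0. bounded_variation_upto (\<lambda>t. A t \<omega>) T)"

definition semimartingale ::
    "'a measure \<Rightarrow> (real \<Rightarrow> 'a measure) \<Rightarrow> (real \<Rightarrow> 'a \<Rightarrow> real) \<Rightarrow> bool" where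
  "semimartingale P F X \<longleftrightarrow>
     adapted F X \<and> cadlag_process P X \<and>
     (\<exists>M A. local_martingale P F M \<and> finite_variation_process P F A \<and>
        (\<forall>\<omega>\<in>space P. M 0 \<omega> = 0 \<and> A 0 \<omega> = 0) \<and>
        (\<forall>\<omega>\<in>space P. \<forall>t\<ge>0. X t \<omega> = X 0 \<omega> + M t \<omega> + A t \<omega>))"

end

theory Submission
  imports Defs
begin

text \<open>One jump at a uniformly distributed time suffices: \<open>X\<^sub>t = 1\<close> if \<open>t \<ge> \<omega>\<close> and
  \<open>X\<^sub>t = 0\<close> otherwise, where \<open>\<omega>\<close> is uniform on \<open>(0, 1]\<close>. The path has finite variation and
  jumps exactly at \<open>\<omega>\<close>, whereas the limes inferior of a sequence of finite sets is countable
  and therefore a null set. The filtration is irrelevant and taken to be constant.\<close>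

text \<open>Each tail intersection lies inside its first set \<open>\<pi> n\<close>, so a countable
  union of countable sets remains.\<close>

lemma countable_liminf_sets:
  assumes "\<And>n. 1 \<le> n \<Longrightarrow> countable (\<pi> n)"
  shows "countable (liminf_sets \<pi>)"
proof -
  have "countable (\<Inter>k\<in>{n..}. \<pi> k)" if "1 \<le> n" for n
    by (rule countable_subset[OF _ assms[OF that]]) auto
  then show ?thesis
    unfolding liminf_sets_def by (intro countable_UN) auto
qed

text \<open>Increments of a monotone path are nonnegative, so their absolute values telescope and
  the total increase \<open>x T - x 0\<close> bounds every sum.\<close>

lemma mono_bounded_variation_upto:
  assumes "mono x" and "0 \<le> T"
  shows "bounded_variation_upto x T"
  unfolding bounded_variation_upto_def
proof (intro exI[of _ "x T - x 0"] allI impI)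
  fix ts :: "real list" assume ts: "sorted ts \<and> set ts \<subseteq> {0..T}"
  show "(\<Sum>i<length ts - 1. \<bar>x (ts ! Suc i) - x (ts ! i)\<bar>) \<le> x T - x 0"
  \<comment> \<open>The telescoped end points \<open>ts ! 0\<close> and
    \<open>ts ! (length ts - 1)\<close> are known to lie in \<open>{0..T}\<close> only for a
    nonempty list.\<close>
  proof (cases "ts = []")
    case True
    then show ?thesis using monoD[OF assms] by simp
  next
    case False
    have "(\<Sum>i<length ts - 1. \<bar>x (ts ! Suc i) - x (ts ! i)\<bar>)
        = (\<Sum>i<length ts - 1. x (ts ! Suc i) - x (ts ! i))"
      using ts by (intro sum.cong) (auto intro!: abs_of_nonneg monoD[OF \<open>mono x\<close>] sorted_nth_mono)
    also have "\<dots> = x (ts ! (length ts - 1)) - x (ts ! 0)"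
      by (rule sum_lessThan_telescope)
    also have "\<dots> \<le> x T - x 0"
    proof -
      have "ts ! (length ts - 1) \<in> {0..T}" "ts ! 0 \<in> {0..T}"
        using ts False by (auto simp: subset_iff)
      then show ?thesis by (intro diff_mono monoD[OF \<open>mono x\<close>]) auto
    qed
    finally show ?thesis .
  qed
qed

text \<open>The step function is constant just to the left of every \<open>t\<close>. The open
  half-line in the limit differs from the closed one only at \<open>t = a\<close>, which is where
  the jump comes from.\<close>

lemma tendsto_indicator_atLeast_at_left:
  fixes a t :: real
  shows "(indicator {a..} \<longlongrightarrow> (indicator {a<..} t :: real)) (at_left t)"
proof (rule tendsto_eventually, cases "a < t")
  case True
  then show "\<forall>\<^sub>F s in at_left t. indicator {a..} s = (indicator {a<..} t :: real)"
    by (intro eventually_mono[OF eventually_at_left_real[OF True]]) auto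
next
  case False
  then show "\<forall>\<^sub>F s in at_left t. indicator {a..} s = (indicator {a<..} t :: real)"
    by (auto simp: eventually_at_filter)
qed

lemma tendsto_indicator_atLeast_at_right:
  fixes a t :: real
  shows "(indicator {a..} \<longlongrightarrow> (indicator {a..} t :: real)) (at_right t)"
proof (rule tendsto_eventually, cases "t < a")
  case True
  then show "\<forall>\<^sub>F s in at_right t. indicator {a..} s = (indicator {a..} t :: real)"
    by (intro eventually_mono[OF eventually_at_right_real[OF True]]) auto
next
  case False
  then show "\<forall>\<^sub>F s in at_right t. indicator {a..} s = (indicator {a..} t :: real)"
    by (auto simp: eventually_at_filter)
qed

lemma cadlag_indicator_atLeast: "cadlag (indicator {a..})"
  using tendsto_indicator_atLeast_at_left tendsto_indicator_atLeast_at_right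
  by (auto simp: cadlag_def continuous_within)

text \<open>Positivity of \<open>a\<close> matters: by the convention
  \<open>left_lim x 0 = x 0\<close>, a step at \<open>0\<close> is not a jump.\<close>

lemma jump_times_indicator_atLeast:
  assumes "0 < a"
  shows "jump_times (indicator {a..}) = {a}"
proof -
  have "Lim (at_left t) (indicator {a..}) = (indicator {a<..} t :: real)" for t
    using tendsto_indicator_atLeast_at_left by (intro tendsto_Lim) auto
  then show ?thesis
    using assms by (auto simp: jump_times_def left_lim_def indicator_def split: if_splits)
qed

lemma (in filtered_prob_space) martingale_zero: "martingale P F (\<lambda>t \<omega>. 0)"
proof -
  have "AE \<omega> in P. real_cond_exp P (F s) (\<lambda>\<omega>. 0) \<omega> = 0" if "0 \<le> s" for s
  proof -
    interpret finite_measure_subalgebra P "F s"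
      by unfold_locales (rule subalgebra_F[OF that])
    show ?thesis
      by (rule real_cond_exp_F_meas) auto
  qed
  then show ?thesis
    by (auto simp: martingale_def adapted_def)
qed

text \<open>Stopping does not change the zero process, so the constant times
  \<open>\<infinity>\<close> localize it; the events that they have occurred by a finite time are
  empty.\<close>

lemma (in filtered_prob_space) local_martingale_zero: "local_martingale P F (\<lambda>t \<omega>. 0)"
  unfolding local_martingale_def
proof (intro conjI exI[of _ "\<lambda>n \<omega>. \<infinity>"] allI)
  show "adapted F (\<lambda>t \<omega>. 0)"
    by (simp add: adapted_def)
  show "cadlag_process P (\<lambda>t \<omega>. 0)"
    by (auto simp: cadlag_process_def cadlag_def)
  show "ext_stopping_time P F (\<lambda>\<omega>. \<infinity>)"
    by (simp add: ext_stopping_time_def top_unique)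
  show "AE \<omega> in P. incseq (\<lambda>n::nat. \<infinity>::ennreal) \<and> (\<lambda>n::nat. \<infinity>::ennreal) \<longlonglongrightarrow> \<infinity>"
    by (simp add: incseq_def)
  show "martingale P F (\<lambda>t \<omega>. stopped (\<lambda>t \<omega>. 0) (\<lambda>\<omega>. \<infinity>) t \<omega> - 0)"
    using martingale_zero by (simp add: stopped_def)
qed

text \<open>The decomposition has zero martingale part and \<open>A\<close> itself as finite
  variation part, which is consistent because \<open>A\<close> starts at \<open>0\<close>.\<close>

lemma (in filtered_prob_space) finite_variation_imp_semimartingale:
  assumes "finite_variation_process P F A" and "\<And>\<omega>. \<omega> \<in> space P \<Longrightarrow> A 0 \<omega> = 0"
  shows "semimartingale P F A"
  unfolding semimartingale_def
proof (intro conjI)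
  show "adapted F A" "cadlag_process P A"
    using assms(1) by (simp_all add: finite_variation_process_def)
qed (rule exI[of _ "\<lambda>t \<omega>. 0"], rule exI[of _ A], use assms local_martingale_zero in simp)

theorem proposition1p1:
  shows "\<exists>(P :: real measure) (F :: real \<Rightarrow> real measure) (X :: real \<Rightarrow> real \<Rightarrow> real).
     filtered_prob_space P F \<and>
     semimartingale P F X \<and>
     cadlag_process P X \<and>
     (\<forall>\<pi> :: nat \<Rightarrow> real set. partition_sequence \<pi> \<longrightarrow>
        {\<omega> \<in> space P. jump_times (\<lambda>t. X t \<omega>) \<subseteq> liminf_sets \<pi>} \<in> sets P \<and>
        measure P {\<omega> \<in> space P. jump_times (\<lambda>t. X t \<omega>) \<subseteq> liminf_sets \<pi>} = 0)"
proof -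
  \<comment> \<open>Leaving out \<open>0\<close> gives \<open>X 0 \<omega> = 0\<close> and makes the
    step at \<open>\<omega>\<close> a genuine jump for every outcome.\<close>
  define P :: "real measure" where "P = restrict_space lborel {0<..1}"
  define X :: "real \<Rightarrow> real \<Rightarrow> real" where "X = (\<lambda>t \<omega>. indicator {\<omega>..} t)"
  have space_P: "space P = {0<..1}"
    by (simp add: P_def space_restrict_space)
  have "prob_space P"
    unfolding P_def by (rule prob_space_restrict_space) auto
  then interpret filtered_prob_space P "\<lambda>_. P"
    by (simp add: filtered_prob_space_def filtered_prob_space_axioms_def subalgebra_def)
  have cadlag: "cadlag_process P X"
    by (simp add: cadlag_process_def X_def cadlag_indicator_atLeast)
  have "X t \<in> borel_measurable P" for t
  proof -
    \<comment> \<open>For fixed \<open>t\<close> the roles of time and outcome are exchanged: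
      \<open>\<omega> \<le> t\<close> defines a Borel set of outcomes.\<close>
    have "X t = indicator {..t}"
      by (auto simp: X_def indicator_def fun_eq_iff)
    then show ?thesis
      unfolding P_def by (simp add: measurable_restrict_space1)
  qed
  moreover have "bounded_variation_upto (\<lambda>t. X t \<omega>) T" if "0 \<le> T" for \<omega> T
    using that by (intro mono_bounded_variation_upto) (auto simp: X_def mono_def indicator_def)
  ultimately have "finite_variation_process P (\<lambda>_. P) X"
    using cadlag by (simp add: finite_variation_process_def adapted_def)
  then have semimartingale: "semimartingale P (\<lambda>_. P) X"
    by (rule finite_variation_imp_semimartingale) (auto simp: X_def space_P)
  \<comment> \<open>Membership in \<open>null_sets P\<close> yields measurability and probability
    zero together. As the jump set is the singleton of \<open>\<omega>\<close>, inclusion reduces to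
    membership of \<open>\<omega>\<close>.\<close>
  have "{\<omega> \<in> space P. jump_times (\<lambda>t. X t \<omega>) \<subseteq> liminf_sets \<pi>} \<in> null_sets P"
    if "partition_sequence \<pi>" for \<pi>
  proof -
    have "{\<omega> \<in> space P. jump_times (\<lambda>t. X t \<omega>) \<subseteq> liminf_sets \<pi>} = {0<..1} \<inter> liminf_sets \<pi>"
      by (auto simp: X_def space_P jump_times_indicator_atLeast)
    moreover have "countable (liminf_sets \<pi>)"
      using that by (intro countable_liminf_sets countable_finite) (simp add: partition_sequence_def)
    then have "{0<..1} \<inter> liminf_sets \<pi> \<in> null_sets lborel"
      by (intro countable_imp_null_set_lborel) auto
    ultimately show ?thesis
      by (simp add: P_def null_sets_restrict_space)
  qed
  then show ?thesis
    using filtered_prob_space_axioms semimartingale cadlag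
    by (intro exI[of _ P] exI[of _ "\<lambda>_. P"] exI[of _ X])
      (auto simp: null_sets_def measure_def)
qed

end
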